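(* For every countable ordinal number $\alpha$ and every $p\in\omega$, there exists a compact countable set $K\subset\mathbb{R}$ such that $|K^{(\alpha)}|=p$.
   Context: A countable set is one that is either finite (possibly empty) or countably infinite; $\omega$ is the set of natural numbers (including $0$); $|B|$ denotes the cardinality of a set $B$. For $A\subset\mathbb{R}$, $A'$ denotes the derived set (set of all limit points) of $A$, and the Cantor-Bendixson derivatives are defined by transfinite recursion: $A^{(0)}=A$; $A^{(\beta+1)}=(A^{(\beta)})'$ for every ordinal $\beta$; $A^{(\lambda)}=\bigcap_{\gamma<\lambda}A^{(\gamma)}$ for every limit ordinal $\lambda\neq 0$. *)

theory Defs
  imports "HOL-Analysis.Analysis" "HOL-Library.Countable_Set_Type"
begin

text \<open>
  The countable ordinals are the elements of the first uncountable ordinal, which the library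
  provides as the cardinal successor of \<^const>\<open>natLeq\<close>.  The lemmas
  \<open>countable_lessThan_countable_ordinal\<close> and \<open>countable_ordinal_exhaustive\<close> below show that every
  element has only countably many predecessors and that every countable well-order is the
  order type of the predecessors of some element.
\<close>

typedef countable_ordinal = "Field (cardSuc natLeq)"
proof -
  have "Field (cardSuc natLeq) \<noteq> {}"
    using cardSuc_finite[OF natLeq_Card_order] by (auto simp: Field_natLeq)
  then show ?thesis by blast
qed

lemma Well_order_cardSuc_natLeq: "Well_order (cardSuc natLeq)"
  using cardSuc_Card_order[OF natLeq_Card_order] card_order_on_well_order_on by blast

instantiation countable_ordinal :: wellorder
begin

definition less_eq_countable_ordinal :: "countable_ordinal \<Rightarrow> countable_ordinal \<Rightarrow> bool" where
  "\<alpha> \<le> \<beta> \<longleftrightarrow> (Rep_countable_ordinal \<alpha>, Rep_countable_ordinal \<beta>) \<in> cardSuc natLeq"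

definition less_countable_ordinal :: "countable_ordinal \<Rightarrow> countable_ordinal \<Rightarrow> bool" where
  "\<alpha> < \<beta> \<longleftrightarrow> \<alpha> \<le> \<beta> \<and> \<not> \<beta> \<le> (\<alpha> :: countable_ordinal)"

instance
proof -
  let ?r = "cardSuc natLeq"
  interpret wo_rel ?r
    using Well_order_cardSuc_natLeq by (simp add: wo_rel_def)
  note Rep = Rep_countable_ordinal
  have refl: "(x, x) \<in> ?r" if "x \<in> Field ?r" for x
    using REFL that by (simp add: refl_on_def)
  have total: "(x, y) \<in> ?r \<or> (y, x) \<in> ?r" if "x \<in> Field ?r" "y \<in> Field ?r" for x y
    using TOTALS that by blast
  have anti: "x = y" if "(x, y) \<in> ?r" "(y, x) \<in> ?r" for x y
    using ANTISYM that by (meson antisymD)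
  show "OFCLASS(countable_ordinal, wellorder_class)"
  proof (standard, goal_cases)
    case 1 show ?case by (simp add: less_countable_ordinal_def)
  next
    case (2 x) show ?case by (simp add: less_eq_countable_ordinal_def refl Rep)
  next
    case (3 x y z) then show ?case
      unfolding less_eq_countable_ordinal_def by (rule transD[OF TRANS])
  next
    case (4 x y) then show ?case
      unfolding less_eq_countable_ordinal_def
      using anti[of "Rep_countable_ordinal x" "Rep_countable_ordinal y"]
        Rep_countable_ordinal_inject[of x y] by simp
  next
    case (5 x y) show ?case
      unfolding less_eq_countable_ordinal_def using total[OF Rep Rep] .
  next
    case (6 P a)
    have "wf (inv_image (?r - Id) Rep_countable_ordinal)"
      using WF by (rule wf_inv_image)
    then show ?case
    proof (induction a rule: wf_induct_rule)
      case (less x)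
      show ?case
      proof (rule 6)
        fix y assume "y < x"
        then have "(y, x) \<in> inv_image (?r - Id) Rep_countable_ordinal"
          unfolding less_countable_ordinal_def less_eq_countable_ordinal_def
          by auto
        then show "P y" by (rule less.IH)
      qed
    qed
  qed
qed

end

lemma less_countable_ordinal_iff:
  "\<alpha> < \<beta> \<longleftrightarrow> Rep_countable_ordinal \<alpha> \<in> underS (cardSuc natLeq) (Rep_countable_ordinal \<beta>)"
proof -
  have "\<alpha> < \<beta> \<longleftrightarrow> \<alpha> \<le> \<beta> \<and> \<alpha> \<noteq> \<beta>" by auto
  then show ?thesis
    by (auto simp: underS_def less_eq_countable_ordinal_def Rep_countable_ordinal_inject)
qed

lemma Rep_image_lessThan:
  "Rep_countable_ordinal ` {..<\<alpha>} = underS (cardSuc natLeq) (Rep_countable_ordinal \<alpha>)"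
proof (intro equalityI subsetI)
  fix x assume x: "x \<in> underS (cardSuc natLeq) (Rep_countable_ordinal \<alpha>)"
  then have "x \<in> Field (cardSuc natLeq)" by (auto simp: underS_def Field_def)
  then obtain \<beta> where "x = Rep_countable_ordinal \<beta>"
    by (rule Rep_countable_ordinal_cases)
  then show "x \<in> Rep_countable_ordinal ` {..<\<alpha>}"
    using x by (auto simp: less_countable_ordinal_iff)
qed (auto simp: less_countable_ordinal_iff)

lemma countable_lessThan_countable_ordinal:
  fixes \<alpha> :: countable_ordinal
  shows "countable {..<\<alpha>}"
  including cardinal_syntax
proof -
  have "|underS (cardSuc natLeq) (Rep_countable_ordinal \<alpha>)| <o cardSuc natLeq"
    by (intro card_of_underS cardSuc_Card_order natLeq_Card_order Rep_countable_ordinal)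
  then have "countable (Rep_countable_ordinal ` {..<\<alpha>})"
    by (simp add: Rep_image_lessThan countable_card_le_natLeq
        cardSuc_ordLeq_ordLess[OF natLeq_Card_order card_of_Card_order])
  moreover have "inj_on Rep_countable_ordinal {..<\<alpha>}"
    by (simp add: inj_on_def Rep_countable_ordinal_inject)
  ultimately show ?thesis by (rule countable_image_inj_on)
qed

lemma countable_ordinal_exhaustive:
  fixes r :: "'a rel"
  assumes "Well_order r" "countable (Field r)"
  shows "\<exists>\<alpha> :: countable_ordinal. (r, {(\<beta>, \<gamma>). \<beta> \<le> \<gamma> \<and> \<gamma> < \<alpha>}) \<in> ordIso"
  including cardinal_syntax
proof -
  let ?s = "cardSuc natLeq"
  have "|Field r| <o ?s"
    using assms(2)
    by (simp add: countable_card_le_natLeq cardSuc_ordLeq_ordLess[OF natLeq_Card_order card_of_Card_order])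
  have "r <o ?s"
  proof (rule ccontr)
    assume "\<not> r <o ?s"
    then have "?s \<le>o r"
      using assms(1) Well_order_cardSuc_natLeq not_ordLess_iff_ordLeq by blast
    then have "|Field ?s| \<le>o |Field r|" by (rule card_of_mono2)
    then have "?s \<le>o |Field r|"
      using cardSuc_Card_order[OF natLeq_Card_order] card_of_Field_ordIso
        ordIso_symmetric ordIso_ordLeq_trans by blast
    with \<open>|Field r| <o ?s\<close> show False
      using not_ordLess_ordLeq by blast
  qed
  then obtain a where a: "a \<in> Field ?s" "(r, Restr ?s (underS ?s a)) \<in> ordIso"
    using ordLess_iff_ordIso_Restr[OF Well_order_cardSuc_natLeq assms(1)] by blast
  define \<alpha> where "\<alpha> = Abs_countable_ordinal a"
  have Rep: "Rep_countable_ordinal \<alpha> = a"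
    by (simp add: \<alpha>_def Abs_countable_ordinal_inverse a)
  let ?t = "{(\<beta>, \<gamma>). \<beta> \<le> \<gamma> \<and> \<gamma> < \<alpha>}"
  have F: "Field ?t = {..<\<alpha>}"
    by (auto simp: Field_def)
  have im: "Restr ?s (underS ?s a) = dir_image ?t Rep_countable_ordinal"
  proof -
    have "(x, y) \<in> dir_image ?t Rep_countable_ordinal"
      if "(x, y) \<in> ?s" "x \<in> underS ?s a" "y \<in> underS ?s a" for x y
    proof -
      have "x \<in> Rep_countable_ordinal ` {..<\<alpha>}" "y \<in> Rep_countable_ordinal ` {..<\<alpha>}"
        using that by (simp_all add: Rep_image_lessThan Rep)
      then obtain \<beta> \<gamma> where "x = Rep_countable_ordinal \<beta>" "y = Rep_countable_ordinal \<gamma>"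
          "\<beta> < \<alpha>" "\<gamma> < \<alpha>"
        by blast
      then show ?thesis
        using that(1) by (auto simp: dir_image_def less_eq_countable_ordinal_def)
    qed
    moreover have "(x, y) \<in> Restr ?s (underS ?s a)"
      if "(x, y) \<in> dir_image ?t Rep_countable_ordinal" for x y
    proof -
      from that obtain \<beta> \<gamma> where *: "x = Rep_countable_ordinal \<beta>" "y = Rep_countable_ordinal \<gamma>"
          "\<beta> \<le> \<gamma>" "\<gamma> < \<alpha>"
        by (auto simp: dir_image_def)
      then have "\<beta> < \<alpha>" by simp
      with * show ?thesis
        by (auto simp: less_countable_ordinal_iff Rep less_eq_countable_ordinal_def)
    qed
    ultimately show ?thesis by auto
  qed
  have "Well_order ?t"
    unfolding well_order_on_def linear_order_on_def partial_order_on_def preorder_on_def F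
  proof (intro conjI)
    show "refl_on {..<\<alpha>} ?t" by (auto simp: refl_on_def)
    show "trans ?t" by (auto intro!: transI)
    show "antisym ?t" by (auto intro!: antisymI)
    show "total_on {..<\<alpha>} ?t" by (auto simp: total_on_def)
    show "wf (?t - Id)"
      by (rule wf_subset[OF wf]) auto
  qed (auto simp: Field_def)
  then have "(?t, Restr ?s (underS ?s a)) \<in> ordIso"
    unfolding im by (rule dir_image_ordIso) (simp add: inj_on_def Rep_countable_ordinal_inject)
  then show ?thesis
    using a(2) ordIso_symmetric ordIso_transitive by blast
qed

text \<open>
  The ordinals below \<open>\<alpha>\<close> being exactly those up to \<open>\<beta>\<close> means \<open>\<alpha> = \<beta> + 1\<close>.  The third branch
  covers the nonzero limit ordinals.
\<close>

function cb_deriv :: "'b::topological_space set \<Rightarrow> 'a::wellorder \<Rightarrow> 'b set" where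
  "cb_deriv A \<alpha> =
     (if {..<\<alpha>} = {} then A
      else if \<exists>\<beta>. {..<\<alpha>} = {..\<beta>}
        then euclidean derived_set_of (cb_deriv A (THE \<beta>. {..<\<alpha>} = {..\<beta>}))
      else (\<Inter>\<gamma>\<in>{..<\<alpha>}. cb_deriv A \<gamma>))"
  by pat_completeness auto
termination
proof (relation "inv_image {(x, y). x < y} snd", goal_cases)
  case 1 show ?case by (intro wf_inv_image wf)
next
  case (2 A \<alpha>)
  then obtain \<beta> where "{..<\<alpha>} = {..\<beta>}" by blast
  moreover from this have "(THE \<beta>. {..<\<alpha>} = {..\<beta>}) = \<beta>"
    by (intro the_equality) auto
  ultimately show ?case by auto
qed auto

declare cb_deriv.simps [simp del]

lemma cb_deriv_zero: "{..<\<alpha>} = {} \<Longrightarrow> cb_deriv A \<alpha> = A"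
  by (simp add: cb_deriv.simps)

lemma cb_deriv_succ:
  assumes "{..<\<alpha>} = {..\<beta>}"
  shows "cb_deriv A \<alpha> = {x. x islimpt cb_deriv A \<beta>}"
proof -
  have "(THE \<beta>. {..<\<alpha>} = {..\<beta>}) = \<beta>"
    using assms by (intro the_equality) auto
  moreover have "{..<\<alpha>} \<noteq> {}" using assms by auto
  ultimately have "cb_deriv A \<alpha> = euclidean derived_set_of (cb_deriv A \<beta>)"
    using assms by (subst cb_deriv.simps) auto
  then show ?thesis
    by (auto simp: derived_set_of_def islimpt_def)
qed

lemma cb_deriv_limit:
  assumes "{..<\<alpha>} \<noteq> {}" "\<nexists>\<beta>. {..<\<alpha>} = {..\<beta>}"
  shows "cb_deriv A \<alpha> = (\<Inter>\<gamma>\<in>{..<\<alpha>}. cb_deriv A \<gamma>)"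
  using assms by (subst cb_deriv.simps) auto

end

theory Submission
  imports Defs
begin

text \<open>
  By induction on \<open>\<alpha>\<close>, every open interval contains a countable compact set whose derivative of
  order \<open>\<alpha>\<close> is a single point.  For \<open>\<alpha> > 0\<close>, take a sequence increasing to \<open>c\<close>, put into its
  consecutive gaps sets that reduce to one point at order \<open>\<beta>\<close>, with each \<open>\<beta> < \<alpha>\<close> serving
  infinitely many gaps, and add \<open>c\<close>.  As derivatives are local, the derivative of order \<open>\<alpha>\<close> is
  empty in each gap, while \<open>c\<close> is a limit point of every earlier derivative.  The union of \<open>p\<close> such
  sets in disjoint intervals proves the theorem.
\<close>

section \<open>Derivatives of closed sets in T1 spaces\<close>

lemma closed_limpts_t1: "closed {x :: 'a::t1_space. x islimpt S}"
  unfolding closed_limpt mem_Collect_eq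
proof (intro allI impI islimptI)
  fix x T assume x: "x islimpt {x. x islimpt S}" and T: "x \<in> T" "open T"
  obtain y where y: "y islimpt S" "y \<in> T" "y \<noteq> x"
    using islimptE[OF x T] by blast
  \<comment> \<open>Points are closed in a T1 space, so \<open>T - {x}\<close> is still a
    neighbourhood of \<open>y\<close>; the point of \<open>S\<close> found in it cannot be
    \<open>x\<close>.\<close>
  then show "\<exists>z\<in>S. z \<in> T \<and> z \<noteq> x"
    using islimptE[OF y(1), of "T - {x}"] T(2) by (auto simp: open_Diff)
qed

text \<open>The two claims need each other: closed stages contain their own limit points, which
  makes the stages below \<alpha> decrease and yields the formula; the formula in turn exhibits
  stage \<alpha> as an intersection of closed sets.\<close>

lemma cb_deriv_closed_aux:
  fixes A :: "'b::t1_space set" and \<alpha> :: "'a::wellorder"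
  assumes "closed A"
  shows "closed (cb_deriv A \<alpha>) \<and> cb_deriv A \<alpha> = A \<inter> (\<Inter>\<beta>\<in>{..<\<alpha>}. {x. x islimpt cb_deriv A \<beta>})"
proof (induction \<alpha> rule: less_induct)
  case (less \<alpha>)
  let ?D = "\<lambda>\<beta>. {x. x islimpt cb_deriv A \<beta>}"
  have lim: "?D \<beta> \<subseteq> cb_deriv A \<beta>" if "\<beta> < \<alpha>" for \<beta>
    using less.IH[OF that] closed_limpt by blast
  have sub: "cb_deriv A \<beta> \<subseteq> A" if "\<beta> < \<alpha>" for \<beta>
    using less.IH[OF that] by blast
  have step: "cb_deriv A \<gamma> \<subseteq> ?D \<beta>" if "\<beta> < \<gamma>" "\<gamma> < \<alpha>" for \<beta> \<gamma>
    using less.IH[OF that(2)] that(1) by blast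
  have eq: "cb_deriv A \<alpha> = A \<inter> (\<Inter>\<beta>\<in>{..<\<alpha>}. ?D \<beta>)"
  proof (cases "{..<\<alpha>} = {}")
    case True
    then show ?thesis by (simp add: cb_deriv_zero)
  next
    case nonzero: False
    show ?thesis
    proof (cases "\<exists>\<gamma>. {..<\<alpha>} = {..\<gamma>}")
      case True
      then obtain \<gamma> where \<gamma>: "{..<\<alpha>} = {..\<gamma>}" by blast
      then have "\<gamma> < \<alpha>" by blast
      \<comment> \<open>The stages decrease, so the set belonging to the predecessor \<gamma> is the
        smallest one and alone determines the intersection.\<close>
      have "?D \<gamma> \<subseteq> ?D \<beta>" if "\<beta> < \<alpha>" for \<beta>
      proof (cases "\<beta> = \<gamma>")
        case False
        have "\<beta> \<in> {..\<gamma>}" unfolding \<gamma>[symmetric] using that by simp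
        with False have "\<beta> < \<gamma>" by simp
        then have "cb_deriv A \<gamma> \<subseteq> cb_deriv A \<beta>"
          using step[OF _ \<open>\<gamma> < \<alpha>\<close>] lim[OF that] by blast
        then show ?thesis using islimpt_subset by blast
      qed simp
      then show ?thesis
        using cb_deriv_succ[OF \<gamma>, of A] lim[OF \<open>\<gamma> < \<alpha>\<close>] sub[OF \<open>\<gamma> < \<alpha>\<close>] \<open>\<gamma> < \<alpha>\<close> by auto
    next
      case False
      have inter: "(\<Inter>\<gamma>\<in>{..<\<alpha>}. cb_deriv A \<gamma>) \<subseteq> ?D \<beta>" if "\<beta> < \<alpha>" for \<beta>
      proof -
        \<comment> \<open>There is no largest ordinal below \<alpha>, so some stage \<gamma> comes
          strictly between; it consists of limit points of stage \<beta>.\<close>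
        have "\<exists>\<gamma>. \<beta> < \<gamma> \<and> \<gamma> < \<alpha>"
        proof (rule ccontr)
          assume "\<not> ?thesis"
          then have "{..<\<alpha>} = {..\<beta>}" using that by (auto simp: not_less)
          with False show False by blast
        qed
        then show ?thesis using step by blast
      qed
      have "(\<Inter>\<gamma>\<in>{..<\<alpha>}. cb_deriv A \<gamma>) = A \<inter> (\<Inter>\<beta>\<in>{..<\<alpha>}. ?D \<beta>)"
      proof (intro equalityI subsetI)
        fix x assume x: "x \<in> (\<Inter>\<gamma>\<in>{..<\<alpha>}. cb_deriv A \<gamma>)"
        obtain \<gamma> where "\<gamma> < \<alpha>" using nonzero by auto
        then have "x \<in> A" using INT_D[OF x, of \<gamma>] sub[of \<gamma>] by auto
        moreover have "x \<in> ?D \<beta>" if "\<beta> < \<alpha>" for \<beta>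
          using inter[OF that] x by (rule subsetD)
        ultimately show "x \<in> A \<inter> (\<Inter>\<beta>\<in>{..<\<alpha>}. ?D \<beta>)" by simp
      next
        fix x assume "x \<in> A \<inter> (\<Inter>\<beta>\<in>{..<\<alpha>}. ?D \<beta>)"
        then have "x \<in> cb_deriv A \<beta>" if "\<beta> < \<alpha>" for \<beta>
          using lim[OF that] that by auto
        then show "x \<in> (\<Inter>\<gamma>\<in>{..<\<alpha>}. cb_deriv A \<gamma>)" by simp
      qed
      then show ?thesis
        using cb_deriv_limit[OF nonzero False, of A] by simp
    qed
  qed
  moreover have "closed (A \<inter> (\<Inter>\<beta>\<in>{..<\<alpha>}. ?D \<beta>))"
    using assms by (intro closed_Int closed_INT ballI closed_limpts_t1)
  ultimately show ?case by simp
qed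

text \<open>A description without case distinction on \<open>\<alpha>\<close>, valid only for closed sets.\<close>

lemma cb_deriv_closed_eq:
  fixes A :: "'b::t1_space set"
  assumes "closed A"
  shows "cb_deriv A \<alpha> = A \<inter> (\<Inter>\<beta>\<in>{..<\<alpha>}. {x. x islimpt cb_deriv A \<beta>})"
  using cb_deriv_closed_aux[OF assms] by blast

section \<open>Locality of the derivatives\<close>

lemma islimpt_Int_open_cong:
  assumes "open U" "x \<in> U" "A \<inter> U = B \<inter> U"
  shows "x islimpt A \<longleftrightarrow> x islimpt B"
proof -
  have "x islimpt S \<longleftrightarrow> x islimpt (S \<inter> U)" for S
    using assms(1,2) eventually_at_in_open'[of U x]
    by (auto simp: islimpt_iff_eventually elim: eventually_elim2)
  then show ?thesis using assms(3) by metis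
qed

text \<open>Whether a point of the open set \<open>U\<close> is a limit point of a set depends only
  on the trace of that set on \<open>U\<close>. The formula for closed sets carries this through the
  induction without separate successor and limit cases.\<close>

lemma cb_deriv_Int_open_cong:
  fixes A B :: "'b::t1_space set" and \<alpha> :: "'a::wellorder"
  assumes "closed A" "closed B" "open U" "A \<inter> U = B \<inter> U"
  shows "cb_deriv A \<alpha> \<inter> U = cb_deriv B \<alpha> \<inter> U"
proof (induction \<alpha> rule: less_induct)
  case (less \<alpha>)
  have "x islimpt cb_deriv A \<beta> \<longleftrightarrow> x islimpt cb_deriv B \<beta>" if "x \<in> U" "\<beta> < \<alpha>" for x \<beta>
    using islimpt_Int_open_cong[OF assms(3) that(1) less.IH[OF that(2)]] .
  then show ?case
    using assms(4) cb_deriv_closed_eq[OF assms(1), of \<alpha>] cb_deriv_closed_eq[OF assms(2), of \<alpha>]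
    by fastforce
qed

text \<open>Disjointness hides every piece but \<open>L i\<close> from \<open>U i\<close>. Only the
  part of \<open>A\<close> inside \<open>U i\<close> is prescribed, so \<open>A\<close> may have
  further points elsewhere, such as one at which the pieces accumulate.\<close>

lemma cb_deriv_Int_disjoint_family:
  fixes A :: "'b::t1_space set"
  assumes "closed A" "closed (L i)" "\<And>j. j \<in> I \<Longrightarrow> L j \<subseteq> U j" "disjoint_family_on U I" "i \<in> I"
    and "open (U i)" "A \<inter> U i = (\<Union>j\<in>I. L j) \<inter> U i"
  shows "cb_deriv A \<alpha> \<inter> U i = cb_deriv (L i) \<alpha>"
proof -
  have "A \<inter> U i = L i \<inter> U i"
    using assms(3-5,7) by (fastforce simp: disjoint_family_on_def)
  then have "cb_deriv A \<alpha> \<inter> U i = cb_deriv (L i) \<alpha> \<inter> U i"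
    using cb_deriv_Int_open_cong assms by blast
  also have "\<dots> = cb_deriv (L i) \<alpha>"
    using cb_deriv_closed_eq[OF assms(2)] assms(3,5) by blast
  finally show ?thesis .
qed

section \<open>Construction from pieces in consecutive intervals\<close>

lemma disjoint_family_on_consecutive_intervals:
  fixes x :: "nat \<Rightarrow> 'a::linorder"
  assumes "mono x"
  shows "disjoint_family_on (\<lambda>n. {x n<..<x (Suc n)}) I"
proof -
  have "{x m<..<x (Suc m)} \<inter> {x n<..<x (Suc n)} = {}" if "m < n" for m n
    using monoD[OF assms, of "Suc m" n] that by fastforce
  then show ?thesis
    unfolding disjoint_family_on_def by (metis inf_commute linorder_neqE_nat)
qed

text \<open>The pieces can accumulate only at \<open>c\<close>: cutting at each \<open>x N\<close>
  presents the set as an intersection of closed sets, each an interval ending at \<open>c\<close>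
  together with finitely many pieces.\<close>

lemma compact_insert_limit_UN:
  fixes x :: "nat \<Rightarrow> real"
  assumes "mono x" "x \<longlonglongrightarrow> c" and L: "\<And>n. compact (L n)" "\<And>n. L n \<subseteq> {x n<..<x (Suc n)}"
  shows "compact (insert c (\<Union>n. L n))"
proof -
  have xc: "x n \<le> c" for n
    using incseq_le[OF assms(1,2)] .
  have L_in: "y \<in> {x N..c}" if "y \<in> L n" "N \<le> n" for y n N
    using L(2)[of n] that xc[of "Suc n"] monoD[OF assms(1) that(2)] by force
  have "insert c (\<Union>n. L n) = (\<Inter>N. {x N..c} \<union> (\<Union>n<N. L n))" (is "?K = ?R")
  proof (intro equalityI subsetI)
    fix y assume "y \<in> ?K"
    then consider "y = c" | n where "y \<in> L n" by blast
    then show "y \<in> ?R"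
    proof cases
      case 1
      then show ?thesis using xc by simp
    next
      case 2
      have "y \<in> {x N..c} \<union> (\<Union>n<N. L n)" for N
        using L_in[OF 2, of N] 2 by (cases "N \<le> n") auto
      then show ?thesis by blast
    qed
  next
    fix y assume y: "y \<in> ?R"
    show "y \<in> ?K"
    proof (cases "y < c")
      case True
      then obtain N where "y < x N"
        using order_tendstoD(1)[OF assms(2)] by (auto simp: eventually_sequentially)
      moreover have "y \<in> {x N..c} \<union> (\<Union>n<N. L n)" using y by (rule INT_D) simp
      ultimately show ?thesis by auto
    next
      case False
      moreover have "y \<in> {x 0..c}" using INT_D[OF y, of 0] by simp
      ultimately show ?thesis by auto
    qed
  qed
  moreover have "closed ?R"
    using L(1) by (intro closed_INT ballI closed_Un closed_UN) (auto intro: compact_imp_closed)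
  \<comment> \<open>The member for \<open>N = 0\<close> contains no piece separately and is just
    \<open>{x 0..c}\<close>.\<close>
  moreover have "bounded ?R"
    by (rule bounded_subset[of "{x 0..c}"]) (auto dest: spec[of _ 0])
  ultimately show ?thesis
    by (simp add: compact_eq_bounded_closed)
qed

text \<open>The interval is arbitrary so that the induction hypothesis can fill every gap.
  Countability of \<open>{..<\<alpha>}\<close> lets a single sequence of gaps serve all smaller
  ordinals.\<close>

lemma ex_cb_deriv_singleton:
  fixes \<alpha> :: "'a::wellorder" and a b :: real
  assumes "countable {..<\<alpha>}" "a < b"
  shows "\<exists>K c. compact K \<and> countable K \<and> K \<subseteq> {a<..<b} \<and> cb_deriv K \<alpha> = {c}"
  using assms
proof (induction \<alpha> arbitrary: a b rule: less_induct)
  case (less \<alpha>)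
  define c where "c = (a + b) / 2"
  have c: "a < c" "c < b" using less.prems(2) by (auto simp: c_def)
  show ?case
  proof (cases "{..<\<alpha>} = {}")
    case True
    then show ?thesis
      using c by (intro exI[of _ "{c}"] exI[of _ c]) (auto simp: cb_deriv_zero)
  next
    case nonzero: False
    \<comment> \<open>Dividing by \<open>Suc n\<close> makes the sequence start at \<open>a\<close>,
      rise strictly and tend to \<open>c\<close> without reaching it.\<close>
    define x where "x n = c - (c - a) / real (Suc n)" for n
    have "mono x"
      using c by (auto simp: x_def mono_def intro!: divide_left_mono)
    have x_less: "x n < x (Suc n)" for n
      using c by (simp add: x_def field_simps)
    have x_lim: "x \<longlonglongrightarrow> c"
      unfolding x_def using tendsto_diff[OF tendsto_const LIMSEQ_Suc[OF lim_const_over_n]] by force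
    have xc: "x n < c" for n using c by (simp add: x_def)
    have "x 0 = a" by (simp add: x_def)
    then have ax: "a \<le> x n" for n using monoD[OF \<open>mono x\<close>, of 0 n] by simp
    let ?U = "\<lambda>n. {x n<..<x (Suc n)}"
    \<comment> \<open>The first component of the decoded pair enumerates the smaller ordinals; the
      second is free, so each value recurs at arbitrarily large \<open>n\<close>. If
      \<open>{..<\<alpha>}\<close> is finite, surplus indices default to one of its
      elements.\<close>
    define f where "f n = from_nat_into {..<\<alpha>} (fst (prod_decode n))" for n
    have f: "f n < \<alpha>" for n
      using from_nat_into[OF nonzero] by (auto simp: f_def)
    have f_surj: "\<exists>n\<ge>m. f n = \<beta>" if "\<beta> < \<alpha>" for \<beta> m
    proof -
      have "\<beta> \<in> {..<\<alpha>}" using that by simp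
      then obtain k where "from_nat_into {..<\<alpha>} k = \<beta>"
        using from_nat_into_surj[OF less.prems(1)] by blast
      then have "f (prod_encode (k, m)) = \<beta>" by (simp add: f_def)
      then show ?thesis using le_prod_encode_2 by blast
    qed
    have "\<exists>K z. compact K \<and> countable K \<and> K \<subseteq> ?U n \<and> cb_deriv K (f n) = {z}" for n
    proof (rule less.IH[OF f _ x_less])
      show "countable {..<f n}"
        by (rule countable_subset[OF _ less.prems(1)]) (use f[of n] in auto)
    qed
    then obtain L z where L: "\<And>n. compact (L n)" "\<And>n. countable (L n)" "\<And>n. L n \<subseteq> ?U n"
        and z: "\<And>n. cb_deriv (L n) (f n) = {z n}"
      by metis
    define K where "K = insert c (\<Union>n. L n)"
    have "compact K"
      unfolding K_def using compact_insert_limit_UN[OF \<open>mono x\<close> x_lim L(1,3)] .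
    then have "closed K" by (rule compact_imp_closed)
    have K_sub: "K \<subseteq> {a<..<b}"
    proof -
      have "L n \<subseteq> {a<..<b}" for n
        using L(3)[of n] ax[of n] xc[of "Suc n"] c by force
      then show ?thesis using c by (auto simp: K_def)
    qed
    have loc: "cb_deriv K \<beta> \<inter> ?U n = cb_deriv (L n) \<beta>" for n and \<beta> :: 'a
      using L xc[of "Suc n"]
      by (intro cb_deriv_Int_disjoint_family[where I = UNIV] \<open>closed K\<close>
          disjoint_family_on_consecutive_intervals \<open>mono x\<close>)
        (auto simp: K_def compact_imp_closed)
    have "cb_deriv K \<alpha> \<subseteq> {c}"
    proof -
      \<comment> \<open>Stage \<open>f n\<close> of \<open>L n\<close> is a single point, which has
        no limit points, and \<open>f n < \<alpha>\<close>.\<close>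
      have "cb_deriv (L n) \<alpha> = {}" for n
        using cb_deriv_closed_eq[OF compact_imp_closed[OF L(1)], of n \<alpha>] f[of n] z[of n]
        by (force simp: islimpt_finite)
      moreover have "cb_deriv K \<alpha> \<subseteq> K"
        using cb_deriv_closed_eq[OF \<open>closed K\<close>] by blast
      ultimately show ?thesis
        using loc[of \<alpha>] L(3) unfolding K_def by fast
    qed
    moreover have "c islimpt cb_deriv K \<beta>" if "\<beta> < \<alpha>" for \<beta>
      unfolding islimpt_approachable
    proof (intro allI impI)
      fix e :: real assume "e > 0"
      then obtain m where m: "c - e < x m"
        using order_tendstoD(1)[OF x_lim, of "c - e"] by (auto simp: eventually_sequentially)
      \<comment> \<open>A gap beyond \<open>x m\<close> with \<open>f n = \<beta>\<close> supplies a
        point \<open>z n\<close> of stage \<beta> between \<open>c - e\<close> and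
        \<open>c\<close>.\<close>
      obtain n where n: "n \<ge> m" "f n = \<beta>" using f_surj[OF \<open>\<beta> < \<alpha>\<close>] by blast
      have "z n \<in> cb_deriv K \<beta>" "x n < z n" "z n < x (Suc n)"
        using loc[of \<beta> n] z[of n] n(2) by auto
      moreover have "x m \<le> x n" using monoD[OF \<open>mono x\<close> n(1)] .
      ultimately show "\<exists>y\<in>cb_deriv K \<beta>. y \<noteq> c \<and> dist y c < e"
        using m xc[of "Suc n"] by (intro bexI[of _ "z n"]) (auto simp: dist_real_def)
    qed
    \<comment> \<open>The formula for closed sets settles successor and limit \<alpha> at
      once.\<close>
    then have "c \<in> cb_deriv K \<alpha>"
      using cb_deriv_closed_eq[OF \<open>closed K\<close>, of \<alpha>] by (auto simp: K_def)
    ultimately have "cb_deriv K \<alpha> = {c}" by blast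
    moreover have "countable K" using L(2) by (simp add: K_def)
    ultimately show ?thesis using \<open>compact K\<close> K_sub by blast
  qed
qed

theorem corollary2p1:
  fixes \<alpha> :: countable_ordinal and p :: nat
  shows "\<exists>K :: real set. compact K \<and> countable K \<and>
           finite (cb_deriv K \<alpha>) \<and> card (cb_deriv K \<alpha>) = p"
proof -
  let ?U = "\<lambda>i. {real i<..<real (Suc i)}"
  have "\<exists>K c. compact K \<and> countable K \<and> K \<subseteq> ?U i \<and> cb_deriv K \<alpha> = {c}" for i
    by (intro ex_cb_deriv_singleton countable_lessThan_countable_ordinal) simp
  then obtain L c where L: "\<And>i. compact (L i)" "\<And>i. countable (L i)" "\<And>i. L i \<subseteq> ?U i"
      and c: "\<And>i. cb_deriv (L i) \<alpha> = {c i}"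
    by metis
  define K where "K = (\<Union>i<p. L i)"
  have "compact K" using L(1) by (auto simp: K_def)
  then have "closed K" by (rule compact_imp_closed)
  have disj: "disjoint_family_on ?U I" for I
    by (intro disjoint_family_on_consecutive_intervals monoI) simp
  have loc: "cb_deriv K \<alpha> \<inter> ?U i = {c i}" if "i < p" for i
    unfolding c[symmetric] using L that
    by (intro cb_deriv_Int_disjoint_family[where I = "{..<p}"] \<open>closed K\<close> disj)
      (auto simp: K_def compact_imp_closed)
  \<comment> \<open>Derivatives of the closed set \<open>K\<close> stay inside \<open>K\<close>, so
    no point outside the intervals arises.\<close>
  have "cb_deriv K \<alpha> \<subseteq> (\<Union>i<p. ?U i)"
    using cb_deriv_closed_eq[OF \<open>closed K\<close>, of \<alpha>] L(3) unfolding K_def by blast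
  then have eq: "cb_deriv K \<alpha> = c ` {..<p}"
    using loc by blast
  have "inj_on c {..<p}"
  proof (rule inj_onI)
    fix i j assume ij: "i \<in> {..<p}" "j \<in> {..<p}" "c i = c j"
    then have "c i \<in> ?U i \<inter> ?U j" using loc[of i] loc[of j] by blast
    then show "i = j" using disj[of UNIV] unfolding disjoint_family_on_def by blast
  qed
  then have "card (cb_deriv K \<alpha>) = p" by (simp add: eq card_image)
  moreover have "countable K" using L(2) by (simp add: K_def)
  \<comment> \<open>Since \<open>card\<close> is 0 on infinite sets, finiteness is what gives the
    case \<open>p = 0\<close> its meaning.\<close>
  moreover have "finite (cb_deriv K \<alpha>)" by (simp add: eq)
  ultimately show ?thesis using \<open>compact K\<close> by blast
qed

end
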